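(* Let $n,m,k$ be nonnegative integers. Then in $\widetilde H^*(MO(2);\mathbb F_2)$, $$\mathrm{Sq}^k(v_{n,m})=\sum_{t=0}^{\min\{m+1,\lfloor k/2\rfloor\}}\binom{m+1}{t}\binom{m+n+1-t}{k-2t}\,v_{n+k-2t,\,m+t}.$$
   Context: Let $M=\widetilde H^*(MO(2);\mathbb F_2)$ be the reduced mod $2$ cohomology of the Thom space $MO(2)$ of the universal real two-plane bundle. Write $S=H^*(BO(2);\mathbb F_2)=\mathbb F_2[w_1,w_2]$ with $|w_1|=1$, $|w_2|=2$ (Stiefel--Whitney classes; by the splitting principle $S=\mathbb F_2[x,y]^{\mathfrak S_2}$ with $w_1=x+y$, $w_2=xy$, $|x|=|y|=1$). Then $M=uS$ is free over $S$ on the Thom class $u$ of degree $2$, and the Steenrod squares act on $M$ by the Cartan formula, the usual action on $S$, and the Thom identity $\mathrm{Sq}(u)=u(1+w_1+w_2)$ for the total square $\mathrm{Sq}=\sum_k \mathrm{Sq}^k$. For $n,m\ge 0$ let $v_{n,m}=u\,w_1^n w_2^m$. All binomial coefficients are reduced modulo $2$; for a nonnegative upper entry $a$, $\binom ab=0$ when $b<0$ or $b>a$. *)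

theory Defs
  imports "HOL-Computational_Algebra.Polynomial" "HOL-Library.Z2"
begin

section \<open>The Steenrod squares on the polynomial ring in two variables of degree one\<close>

text \<open>
  The field with two elements is \<^typ>\<open>bit\<close>, and \<^typ>\<open>bit poly poly\<close> is its polynomial ring in
  \<open>x\<close> (the inner variable) and \<open>y\<close> (the outer variable), that is, the cohomology of
  \<open>BO(1) \<times> BO(1)\<close>.
\<close>

definition varx :: "bit poly poly" where "varx = [:[:0, 1:]:]"
definition vary :: "bit poly poly" where "vary = [:0, 1:]"

definition sq_eval_in :: "bit poly \<Rightarrow> bit poly poly poly" where
  "sq_eval_in c = poly (map_poly (\<lambda>a. [:[:[:a:]:]:]) c) [:varx, varx ^ 2:]"

text \<open>
  The total square with a bookkeeping variable \<open>t\<close>, i.e. the sum of \<open>Sq\<^sup>k f \<cdot> t\<^sup>k\<close>. By the Cartan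
  formula and \<open>Sq x = x + x\<^sup>2\<close> for \<open>|x| = 1\<close> it is the ring homomorphism over the field of
  coefficients which sends \<open>x\<close> to \<open>x + x\<^sup>2 t\<close> and \<open>y\<close> to \<open>y + y\<^sup>2 t\<close>; here \<open>t\<close> is the outermost
  variable of \<^typ>\<open>bit poly poly poly\<close>. As \<open>Sq\<^sup>k\<close> raises the degree by \<open>k\<close>, putting \<open>t = 1\<close>
  loses nothing on homogeneous elements, but \<open>t\<close> makes \<open>Sq\<^sup>k\<close> available without splitting
  polynomials into homogeneous components.
\<close>

definition sq_total :: "bit poly poly \<Rightarrow> bit poly poly poly" where
  "sq_total p = poly (map_poly sq_eval_in p) [:vary, vary ^ 2:]"

definition sq_xy :: "nat \<Rightarrow> bit poly poly \<Rightarrow> bit poly poly" where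
  "sq_xy k p = coeff (sq_total p) k"

lemma poly_map_poly_add:
  fixes f :: "'a::comm_semiring_1 \<Rightarrow> 'b::comm_semiring_1"
  assumes "f 0 = 0" "\<And>a b. f (a + b) = f a + f b"
  shows "poly (map_poly f (p + q)) X = poly (map_poly f p) X + poly (map_poly f q) X"
proof -
  have "map_poly f (p + q) = map_poly f p + map_poly f q"
    by (rule poly_eqI) (simp add: coeff_map_poly assms)
  then show ?thesis by simp
qed

lemma poly_map_poly_mult:
  fixes f :: "'a::comm_semiring_1 \<Rightarrow> 'b::comm_semiring_1"
  assumes "f 0 = 0" "\<And>a b. f (a + b) = f a + f b" "\<And>a b. f (a * b) = f a * f b"
  shows "poly (map_poly f (p * q)) X = poly (map_poly f p) X * poly (map_poly f q) X"
proof (induction p)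
  case 0
  then show ?case by simp
next
  case (pCons a p)
  have "map_poly f (smult a q) = smult (f a) (map_poly f q)"
    by (rule poly_eqI) (simp add: coeff_map_poly assms)
  with pCons show ?case
    by (simp add: poly_map_poly_add assms map_poly_pCons algebra_simps)
qed

lemma sq_eval_in_add: "sq_eval_in (a + b) = sq_eval_in a + sq_eval_in b"
  unfolding sq_eval_in_def by (rule poly_map_poly_add) auto

lemma sq_eval_in_mult: "sq_eval_in (a * b) = sq_eval_in a * sq_eval_in b"
  unfolding sq_eval_in_def by (rule poly_map_poly_mult) auto

lemma sq_eval_in_0 [simp]: "sq_eval_in 0 = 0"
  by (simp add: sq_eval_in_def)

lemma sq_total_add: "sq_total (p + q) = sq_total p + sq_total q"
  unfolding sq_total_def by (rule poly_map_poly_add) (auto simp: sq_eval_in_add)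

lemma sq_total_mult: "sq_total (p * q) = sq_total p * sq_total q"
  unfolding sq_total_def
  by (rule poly_map_poly_mult) (auto simp: sq_eval_in_add sq_eval_in_mult)

lemma sq_total_1: "sq_total 1 = 1"
  by (simp add: sq_total_def sq_eval_in_def map_poly_1 one_pCons map_poly_pCons)

lemma sq_total_varx: "sq_total varx = [:varx, varx ^ 2:]"
  by (simp add: sq_total_def varx_def sq_eval_in_def map_poly_pCons flip: one_pCons)

lemma sq_total_vary: "sq_total vary = [:vary, vary ^ 2:]"
  by (simp add: sq_total_def vary_def sq_eval_in_def map_poly_pCons flip: one_pCons)


section \<open>The cohomology of BO(2)\<close>

definition symmetric_xy :: "bit poly poly \<Rightarrow> bool" where
  "symmetric_xy p \<longleftrightarrow> (\<forall>i j. coeff (coeff p i) j = coeff (coeff p j) i)"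

definition transposed_xy :: "bit poly poly \<Rightarrow> bit poly poly \<Rightarrow> bool" where
  "transposed_xy p q \<longleftrightarrow> (\<forall>i j. coeff (coeff p i) j = coeff (coeff q j) i)"

lemma symmetric_xy_transposed: "symmetric_xy p \<longleftrightarrow> transposed_xy p p"
  by (simp add: symmetric_xy_def transposed_xy_def)

lemma transposed_0: "transposed_xy 0 0"
  by (simp add: transposed_xy_def)

lemma transposed_add:
  "transposed_xy p q \<Longrightarrow> transposed_xy p' q' \<Longrightarrow> transposed_xy (p + p') (q + q')"
  by (simp add: transposed_xy_def)

lemma transposed_mult:
  assumes "transposed_xy p q" "transposed_xy p' q'"
  shows "transposed_xy (p * p') (q * q')"
  unfolding transposed_xy_def
proof (intro allI)
  fix i j
  have "coeff (coeff (p * p') i) j =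
      (\<Sum>a\<le>i. \<Sum>b\<le>j. coeff (coeff p a) b * coeff (coeff p' (i - a)) (j - b))"
    by (simp add: coeff_mult coeff_sum)
  also have "\<dots> = (\<Sum>b\<le>j. \<Sum>a\<le>i. coeff (coeff p a) b * coeff (coeff p' (i - a)) (j - b))"
    by (rule sum.swap)
  also have "\<dots> = (\<Sum>b\<le>j. \<Sum>a\<le>i. coeff (coeff q b) a * coeff (coeff q' (j - b)) (i - a))"
    using assms by (simp add: transposed_xy_def)
  also have "\<dots> = coeff (coeff (q * q') j) i"
    by (simp add: coeff_mult coeff_sum)
  finally show "coeff (coeff (p * p') i) j = coeff (coeff (q * q') j) i" .
qed

lemma transposed_sum:
  "(\<And>i. i \<in> A \<Longrightarrow> transposed_xy (f i) (g i)) \<Longrightarrow> transposed_xy (sum f A) (sum g A)"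
  by (induction A rule: infinite_finite_induct) (auto simp: transposed_0 transposed_add)

lemma transposed_const: "transposed_xy [:[:a:]:] [:[:a:]:]"
  by (auto simp: transposed_xy_def coeff_pCons split: nat.splits)

lemma transposed_1: "transposed_xy 1 1"
  using transposed_const[of 1] by (simp add: one_pCons)

lemma transposed_var: "transposed_xy varx vary" "transposed_xy vary varx"
  by (auto simp: transposed_xy_def varx_def vary_def coeff_pCons one_pCons split: nat.splits)

definition transposed_total :: "bit poly poly poly \<Rightarrow> bit poly poly poly \<Rightarrow> bool" where
  "transposed_total P Q \<longleftrightarrow> (\<forall>k. transposed_xy (coeff P k) (coeff Q k))"

lemma transposed_total_mult:
  assumes "transposed_total P Q" "transposed_total P' Q'"
  shows "transposed_total (P * P') (Q * Q')"
  using assms unfolding transposed_total_def coeff_mult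
  by (blast intro: transposed_sum transposed_mult)

lemma transposed_total_sum:
  "(\<And>i. i \<in> A \<Longrightarrow> transposed_total (f i) (g i)) \<Longrightarrow> transposed_total (sum f A) (sum g A)"
  unfolding transposed_total_def coeff_sum by (blast intro: transposed_sum)

lemma transposed_total_const: "transposed_total [:[:[:a:]:]:] [:[:[:a:]:]:]"
  by (auto simp: transposed_total_def coeff_pCons transposed_const transposed_0 split: nat.splits)

lemma transposed_total_var:
  "transposed_total [:varx, varx ^ 2:] [:vary, vary ^ 2:]"
  "transposed_total [:vary, vary ^ 2:] [:varx, varx ^ 2:]"
  by (auto simp: transposed_total_def coeff_pCons transposed_0 transposed_var transposed_mult
      power2_eq_square split: nat.splits)

lemma transposed_total_power:
  assumes "transposed_total P Q"
  shows "transposed_total (P ^ n) (Q ^ n)"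
proof (induction n)
  case 0
  then show ?case using transposed_total_const[of 1] by (simp add: one_pCons)
next
  case (Suc n)
  then show ?case using assms by (simp add: transposed_total_mult)
qed

lemma poly_map_poly_bound:
  fixes f :: "'a::comm_semiring_1 \<Rightarrow> 'b::comm_semiring_1"
  assumes "f 0 = 0" "degree p \<le> N"
  shows "poly (map_poly f p) X = (\<Sum>i\<le>N. f (coeff p i) * X ^ i)"
proof -
  have "degree (map_poly f p) \<le> N"
    using assms(2) by (intro degree_le) (auto simp: coeff_map_poly assms(1) coeff_eq_0)
  then have "poly (map_poly f p) X = (\<Sum>i\<le>N. coeff (map_poly f p) i * X ^ i)"
    unfolding poly_altdef
    by (intro sum.mono_neutral_left) (auto simp: coeff_eq_0 not_le)
  then show ?thesis
    by (simp add: coeff_map_poly assms)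
qed

lemma sq_total_bound:
  assumes "degree p \<le> N" "\<And>i. degree (coeff p i) \<le> N"
  shows "sq_total p = (\<Sum>i\<le>N. \<Sum>j\<le>N.
    [:[:[:coeff (coeff p i) j:]:]:] * [:varx, varx ^ 2:] ^ j * [:vary, vary ^ 2:] ^ i)"
proof -
  have "sq_eval_in (coeff p i) =
      (\<Sum>j\<le>N. [:[:[:coeff (coeff p i) j:]:]:] * [:varx, varx ^ 2:] ^ j)" for i
    unfolding sq_eval_in_def by (rule poly_map_poly_bound) (auto simp: assms)
  then show ?thesis
    unfolding sq_total_def using assms(1)
    by (subst poly_map_poly_bound[where N = N]) (auto simp: sum_distrib_right)
qed

lemma symmetric_sq_xy:
  assumes "symmetric_xy p"
  shows "symmetric_xy (sq_xy k p)"
proof -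
  let ?X = "[:varx, varx ^ 2:]" and ?Y = "[:vary, vary ^ 2:]"
  let ?c = "\<lambda>i j. [:[:[:coeff (coeff p i) j:]:]:]"
  define N where "N = Max (insert (degree p) ((\<lambda>i. degree (coeff p i)) ` {..degree p}))"
  have N1: "degree p \<le> N"
    unfolding N_def by (rule Max_ge) auto
  have N2: "degree (coeff p i) \<le> N" for i
  proof (cases "i \<le> degree p")
    case True
    then show ?thesis unfolding N_def by (intro Max_ge) auto
  next
    case False
    then show ?thesis by (simp add: coeff_eq_0)
  qed
  have eq: "sq_total p = (\<Sum>i\<le>N. \<Sum>j\<le>N. ?c i j * ?X ^ j * ?Y ^ i)"
    using N1 N2 by (rule sq_total_bound)
  also have "transposed_total \<dots> (\<Sum>i\<le>N. \<Sum>j\<le>N. ?c i j * ?Y ^ j * ?X ^ i)"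
    by (intro transposed_total_sum transposed_total_mult transposed_total_power
        transposed_total_const transposed_total_var)
  also have "(\<Sum>i\<le>N. \<Sum>j\<le>N. ?c i j * ?Y ^ j * ?X ^ i) =
      (\<Sum>j\<le>N. \<Sum>i\<le>N. ?c i j * ?Y ^ j * ?X ^ i)"
    by (rule sum.swap)
  also have "\<dots> = (\<Sum>j\<le>N. \<Sum>i\<le>N. ?c j i * ?X ^ i * ?Y ^ j)"
    using assms by (simp add: symmetric_xy_def mult_ac)
  also have "\<dots> = sq_total p"
    by (rule eq[symmetric])
  finally show ?thesis
    by (simp add: transposed_total_def symmetric_xy_transposed sq_xy_def)
qed

text \<open>\<open>S = H\<^sup>*(BO(2))\<close>: by the splitting principle the ring of symmetric polynomials.\<close>

typedef coh_BO2 = "{p. symmetric_xy p}"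
  by (rule exI[of _ 0]) (simp add: symmetric_xy_def)

setup_lifting type_definition_coh_BO2

instantiation coh_BO2 :: comm_ring_1
begin

lift_definition zero_coh_BO2 :: coh_BO2 is 0
  by (simp add: symmetric_xy_def)
lift_definition one_coh_BO2 :: coh_BO2 is 1
  by (simp add: symmetric_xy_transposed transposed_1)
lift_definition plus_coh_BO2 :: "coh_BO2 \<Rightarrow> coh_BO2 \<Rightarrow> coh_BO2" is "(+)"
  by (simp add: symmetric_xy_def)
lift_definition minus_coh_BO2 :: "coh_BO2 \<Rightarrow> coh_BO2 \<Rightarrow> coh_BO2" is "(-)"
  by (simp add: symmetric_xy_def)
lift_definition uminus_coh_BO2 :: "coh_BO2 \<Rightarrow> coh_BO2" is uminus
  by (simp add: symmetric_xy_def)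
lift_definition times_coh_BO2 :: "coh_BO2 \<Rightarrow> coh_BO2 \<Rightarrow> coh_BO2" is "(*)"
  by (simp add: symmetric_xy_transposed transposed_mult)

instance
  by (standard; transfer) (auto simp: algebra_simps)

end

lift_definition const_BO2 :: "bit \<Rightarrow> coh_BO2" is "\<lambda>a. [:[:a:]:]"
  by (simp add: symmetric_xy_transposed transposed_const)

lift_definition w1 :: coh_BO2 is "varx + vary"
  using transposed_add[OF transposed_var] by (simp add: symmetric_xy_transposed add.commute)

lift_definition w2 :: coh_BO2 is "varx * vary"
  using transposed_mult[OF transposed_var] by (simp add: symmetric_xy_transposed mult.commute)

lift_definition Sq_BO2 :: "nat \<Rightarrow> coh_BO2 \<Rightarrow> coh_BO2" is sq_xy
  by (rule symmetric_sq_xy)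

lemma Sq_BO2_add: "Sq_BO2 k (a + b) = Sq_BO2 k a + Sq_BO2 k b"
  by transfer (simp add: sq_xy_def sq_total_add)

lemma Rep_coh_BO2_sum: "Rep_coh_BO2 (sum f A) = (\<Sum>i\<in>A. Rep_coh_BO2 (f i))"
  by (induction A rule: infinite_finite_induct)
    (auto simp: zero_coh_BO2.rep_eq plus_coh_BO2.rep_eq)

lemma Sq_BO2_Cartan: "Sq_BO2 k (a * b) = (\<Sum>i\<le>k. Sq_BO2 i a * Sq_BO2 (k - i) b)"
  by (simp add: Rep_coh_BO2_inject[symmetric] Rep_coh_BO2_sum times_coh_BO2.rep_eq
      Sq_BO2.rep_eq sq_xy_def sq_total_mult coeff_mult)

lemma Sq_BO2_1: "Sq_BO2 k 1 = (if k = 0 then 1 else 0)"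
  by (simp add: Rep_coh_BO2_inject[symmetric] Sq_BO2.rep_eq one_coh_BO2.rep_eq
      zero_coh_BO2.rep_eq sq_xy_def sq_total_1)


section \<open>The reduced cohomology of the Thom space MO(2)\<close>

text \<open>
  The free \<open>S\<close>-module of rank one on the Thom class: \<open>Thom s\<close> is \<open>u s\<close>.
\<close>

datatype coh_MO2 = Thom (unThom: coh_BO2)

instantiation coh_MO2 :: ab_group_add
begin

definition "0 = Thom 0"
definition "a + b = Thom (unThom a + unThom b)"
definition "a - b = Thom (unThom a - unThom b)"
definition "- a = Thom (- unThom a)"

instance
  by standard
    (auto simp: zero_coh_MO2_def plus_coh_MO2_def minus_coh_MO2_def uminus_coh_MO2_def algebra_simps)

end

definition act_BO2 :: "coh_MO2 \<Rightarrow> coh_BO2 \<Rightarrow> coh_MO2" (infixl "\<odot>" 75) where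
  "a \<odot> s = Thom (unThom a * s)"

definition thom_class :: coh_MO2 where
  "thom_class = Thom 1"

definition scale_F2 :: "bit \<Rightarrow> coh_MO2 \<Rightarrow> coh_MO2" (infixr "\<cdot>" 75) where
  "c \<cdot> a = a \<odot> const_BO2 c"

lemma module_coh_MO2: "module (\<lambda>s a. a \<odot> s)"
  by standard (auto simp: act_BO2_def plus_coh_MO2_def algebra_simps)

lemma coh_MO2_free: "\<exists>!s. a = thom_class \<odot> s"
  by (cases a) (auto simp: act_BO2_def thom_class_def)

definition sw_class :: "nat \<Rightarrow> coh_BO2" where
  "sw_class i = (if i = 0 then 1 else if i = 1 then w1 else if i = 2 then w2 else 0)"

text \<open>
  The Thom identity \<open>Sq u = u (1 + w\<^sub>1 + w\<^sub>2)\<close> says that \<open>Sq\<^sup>i u = u w\<^sub>i\<close>, so the Cartan formula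
  for a product \<open>u s\<close> reads as follows.
\<close>

definition Sq :: "nat \<Rightarrow> coh_MO2 \<Rightarrow> coh_MO2" where
  "Sq k a = (\<Sum>i\<le>k. (thom_class \<odot> sw_class i) \<odot> Sq_BO2 (k - i) (unThom a))"

lemma unThom_sum: "unThom (sum f A) = (\<Sum>i\<in>A. unThom (f i))"
  by (induction A rule: infinite_finite_induct) (auto simp: zero_coh_MO2_def plus_coh_MO2_def)

lemma unThom_Sq: "unThom (Sq k a) = (\<Sum>i\<le>k. sw_class i * Sq_BO2 (k - i) (unThom a))"
  by (simp add: Sq_def unThom_sum act_BO2_def thom_class_def)

lemma Sq_thom_class: "Sq k thom_class = thom_class \<odot> sw_class k"
proof -
  have "unThom (Sq k thom_class) = (\<Sum>i\<le>k. if i = k then sw_class i else 0)"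
    unfolding unThom_Sq by (intro sum.cong) (auto simp: thom_class_def Sq_BO2_1)
  then show ?thesis
    by (simp add: coh_MO2.expand act_BO2_def thom_class_def)
qed

lemma Sq_add: "Sq k (a + b) = Sq k a + Sq k b"
  by (simp add: coh_MO2.expand unThom_Sq plus_coh_MO2_def Sq_BO2_add distrib_left sum.distrib)

lemma Sq_Cartan: "Sq k (a \<odot> s) = (\<Sum>i\<le>k. Sq i a \<odot> Sq_BO2 (k - i) s)"
proof -
  let ?g = "\<lambda>i j. sw_class i * (Sq_BO2 j (unThom a) * Sq_BO2 (k - i - j) s)"
  have "unThom (Sq k (a \<odot> s)) = (\<Sum>i\<le>k. \<Sum>j\<le>k - i. ?g i j)"
    by (simp add: unThom_Sq act_BO2_def Sq_BO2_Cartan sum_distrib_left)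
  also have "\<dots> = (\<Sum>l\<le>k. \<Sum>i\<le>l. ?g i (l - i))"
    unfolding sum.Sigma[OF finite_atMost ballI[OF finite_atMost]]
    by (rule sum.reindex_bij_witness[where i = "\<lambda>(l, i). (i, l - i)" and j = "\<lambda>(i, j). (i + j, i)"])
      auto
  also have "\<dots> = unThom (\<Sum>l\<le>k. Sq l a \<odot> Sq_BO2 (k - l) s)"
    by (simp add: unThom_sum act_BO2_def unThom_Sq sum_distrib_right mult.assoc)
  finally show ?thesis
    by (simp add: coh_MO2.expand)
qed

definition v :: "nat \<Rightarrow> nat \<Rightarrow> coh_MO2" where
  "v n m = thom_class \<odot> (w1 ^ n * w2 ^ m)"

end

theory Submission
  imports Defs
begin

text \<open>
  The total square is multiplicative, and in characteristic two it takes \<open>w\<^sub>1\<close> to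
  \<open>w\<^sub>1 (1 + w\<^sub>1 T)\<close> and \<open>w\<^sub>2\<close> to \<open>w\<^sub>2 (1 + w\<^sub>1 T + w\<^sub>2 T\<^sup>2)\<close>. The Thom class contributes one
  more factor \<open>1 + w\<^sub>1 T + w\<^sub>2 T\<^sup>2\<close>, so the total square of \<open>v\<^sub>n\<^sub>,\<^sub>m\<close> is \<open>u\<close> times
  \<open>w\<^sub>1\<^sup>n w\<^sub>2\<^sup>m (1 + w\<^sub>1 T)\<^sup>n ((1 + w\<^sub>1 T) + w\<^sub>2 T\<^sup>2)\<^sup>m\<^sup>+\<^sup>1\<close>. Expanding the last power by the binomial
  theorem and then the powers of \<open>1 + w\<^sub>1 T\<close> gives the coefficient of \<open>T\<^sup>k\<close>.
\<close>

lemma coeff_one_linear_power: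
  fixes a :: "'a::comm_ring_1"
  shows "coeff ([:1, a:] ^ N) j = of_nat (N choose j) * a ^ j"
proof (cases "j \<le> N")
  case True
  then show ?thesis by (simp add: coeff_linear_poly_power)
next
  case False
  \<comment> \<open>Past the degree, the coefficient and the binomial both vanish.\<close>
  have "degree ([:1, a:] ^ N) \<le> degree [:1, a:] * N"
    by (rule degree_power_le)
  also have "\<dots> \<le> N" by simp
  finally show ?thesis using False by (simp add: coeff_eq_0 binomial_eq_0)
qed

lemma coeff_linear_times_quadratic_power:
  fixes a b :: "'a::comm_ring_1"
  shows "coeff ([:1, a:] ^ n * [:1, a, b:] ^ M) k =
    (\<Sum>t = 0..min M (k div 2).
      of_nat (M choose t) * of_nat ((M + n - t) choose (k - 2 * t)) * (a ^ (k - 2 * t) * b ^ t))"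
proof -
  \<comment> \<open>With this grouping, the powers of \<open>[:1, a:]\<close> left by the binomial
    theorem merge with \<open>[:1, a:] ^ n\<close>.\<close>
  have split: "[:1, a, b:] = monom b 2 + [:1, a:]"
    by (simp add: numeral_2_eq_2 monom_Suc monom_0)
  have "[:1, a:] ^ n * [:1, a, b:] ^ M =
      (\<Sum>t\<le>M. of_nat (M choose t) * (monom (b ^ t) (2 * t) * [:1, a:] ^ (M + n - t)))"
    unfolding split binomial_ring sum_distrib_left
  proof (rule sum.cong[OF refl])
    fix t assume "t \<in> {..M}"
    then have e: "M + n - t = n + (M - t)" by simp
    show "[:1, a:] ^ n * (of_nat (M choose t) * monom b 2 ^ t * [:1, a:] ^ (M - t)) =
        of_nat (M choose t) * (monom (b ^ t) (2 * t) * [:1, a:] ^ (M + n - t))"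
      unfolding e power_add by (simp only: monom_power mult_ac)
  qed
  then have "coeff ([:1, a:] ^ n * [:1, a, b:] ^ M) k =
      (\<Sum>t\<le>M. if 2 * t \<le> k then
        of_nat (M choose t) * of_nat ((M + n - t) choose (k - 2 * t)) * (a ^ (k - 2 * t) * b ^ t)
        else 0)"
    by (auto simp: coeff_sum of_nat_poly coeff_monom_mult coeff_one_linear_power mult_ac
        intro!: sum.cong)
  \<comment> \<open>The range keeps exactly the t \<le> M with 2 * t \<le> k; the other terms are
    0.\<close>
  also have "\<dots> = (\<Sum>t = 0..min M (k div 2).
      of_nat (M choose t) * of_nat ((M + n - t) choose (k - 2 * t)) * (a ^ (k - 2 * t) * b ^ t))"
    by (rule sum.mono_neutral_cong_right) auto
  finally show ?thesis .
qed

lemma sq_total_power: "sq_total (p ^ n) = sq_total p ^ n"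
  by (induction n) (simp_all add: sq_total_1 sq_total_mult)

lemma add_self_bit_poly_poly: "p + p = (0 :: bit poly poly)"
proof -
  have "b + b = 0" for b :: bit
    by (cases b) simp_all
  then show ?thesis
    by (intro poly_eqI) (simp only: coeff_add coeff_0)
qed

text \<open>The cross term 2xy vanishes over the field with two elements, so the coefficient of T,
  x^2 + y^2, is the square of x + y.\<close>

lemma sq_total_w1: "sq_total (Rep_coh_BO2 w1) = smult (varx + vary) [:1, varx + vary:]"
proof -
  have "varx * vary + varx * vary = 0"
    by (rule add_self_bit_poly_poly)
  then have "(varx + vary) * (varx + vary) = varx\<^sup>2 + vary\<^sup>2"
    by (simp add: power2_eq_square algebra_simps)
  then show ?thesis
    by (simp add: w1.rep_eq sq_total_add sq_total_varx sq_total_vary)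
qed

text \<open>The quadratic factor is (1 + xT)(1 + yT) multiplied out.\<close>

lemma sq_total_w2:
  "sq_total (Rep_coh_BO2 w2) = smult (varx * vary) [:1, varx + vary, varx * vary:]"
  by (simp add: w2.rep_eq sq_total_mult sq_total_varx sq_total_vary power2_eq_square algebra_simps)

lemma Rep_coh_BO2_power: "Rep_coh_BO2 (s ^ n) = Rep_coh_BO2 s ^ n"
  by (induction n) (simp_all add: one_coh_BO2.rep_eq times_coh_BO2.rep_eq)

lemma Rep_coh_BO2_sw_class:
  "Rep_coh_BO2 (sw_class i) = coeff [:1, varx + vary, varx * vary:] i"
  by (auto simp: sw_class_def coeff_pCons one_coh_BO2.rep_eq zero_coh_BO2.rep_eq w1.rep_eq
      w2.rep_eq numeral_2_eq_2 split: nat.splits)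

lemma Rep_const_BO2_of_nat: "Rep_coh_BO2 (const_BO2 (of_nat c)) = of_nat c"
  by (simp add: const_BO2.rep_eq of_nat_poly)

lemma Rep_unThom_v:
  "Rep_coh_BO2 (unThom (v n m)) = (varx + vary) ^ n * (varx * vary) ^ m"
  by (simp add: v_def act_BO2_def thom_class_def times_coh_BO2.rep_eq Rep_coh_BO2_power w1.rep_eq
      w2.rep_eq)

text \<open>The sum defining \<open>Sq\<close> is a Cauchy product with the generating polynomial of
  the Stiefel-Whitney classes.\<close>

lemma Rep_unThom_Sq:
  "Rep_coh_BO2 (unThom (Sq k a)) =
    coeff ([:1, varx + vary, varx * vary:] * sq_total (Rep_coh_BO2 (unThom a))) k"
  by (simp only: unThom_Sq Rep_coh_BO2_sum times_coh_BO2.rep_eq Rep_coh_BO2_sw_class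
      Sq_BO2.rep_eq sq_xy_def coeff_mult)

lemma sq_total_v:
  "sq_total (Rep_coh_BO2 (unThom (v n m))) =
    smult ((varx + vary) ^ n * (varx * vary) ^ m)
      ([:1, varx + vary:] ^ n * [:1, varx + vary, varx * vary:] ^ m)"
proof -
  have "sq_total (Rep_coh_BO2 (unThom (v n m))) =
      sq_total (Rep_coh_BO2 w1) ^ n * sq_total (Rep_coh_BO2 w2) ^ m"
    by (simp add: Rep_unThom_v sq_total_mult sq_total_power w1.rep_eq w2.rep_eq)
  then show ?thesis
    unfolding sq_total_w1 sq_total_w2 smult_power
    by (simp only: mult_smult_left mult_smult_right smult_smult mult_ac)
qed

theorem theorem3p1:
  fixes n m k :: nat
  shows "Sq k (v n m) =
    (\<Sum>t = 0..min (m + 1) (k div 2).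
      (of_nat ((m + 1) choose t) * of_nat ((m + n + 1 - t) choose (k - 2 * t)) :: bit)
        \<cdot> v (n + k - 2 * t) (m + t))"
proof -
  let ?a = "varx + vary" and ?b = "varx * vary"
  \<comment> \<open>The factor from the Thom class raises the exponent m to m + 1.\<close>
  have "Rep_coh_BO2 (unThom (Sq k (v n m))) =
      ?a ^ n * ?b ^ m * coeff ([:1, ?a:] ^ n * [:1, ?a, ?b:] ^ (m + 1)) k"
    unfolding Rep_unThom_Sq sq_total_v
    by (simp only: mult_smult_right coeff_smult power_add power_one_right mult_ac)
  also have "\<dots> = (\<Sum>t = 0..min (m + 1) (k div 2). ?a ^ n * ?b ^ m *
      (of_nat ((m + 1) choose t) * of_nat ((m + 1 + n - t) choose (k - 2 * t)) *
        (?a ^ (k - 2 * t) * ?b ^ t)))"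
    by (simp only: coeff_linear_times_quadratic_power sum_distrib_left)
  also have "\<dots> = (\<Sum>t = 0..min (m + 1) (k div 2). Rep_coh_BO2 (unThom (
      (of_nat ((m + 1) choose t) * of_nat ((m + n + 1 - t) choose (k - 2 * t)) :: bit)
        \<cdot> v (n + k - 2 * t) (m + t))))"
  proof (rule sum.cong[OF refl])
    fix t assume "t \<in> {0..min (m + 1) (k div 2)}"
    \<comment> \<open>Here 2 * t \<le> k, so truncated subtraction does no harm.\<close>
    then have e: "n + k - 2 * t = n + (k - 2 * t)" by auto
    have e': "m + 1 + n - t = m + n + 1 - t" by simp
    have scale: "Rep_coh_BO2 (unThom (of_nat c \<cdot> a)) = of_nat c * Rep_coh_BO2 (unThom a)" for c a
      by (simp add: scale_F2_def act_BO2_def times_coh_BO2.rep_eq Rep_const_BO2_of_nat mult.commute)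
    show "?a ^ n * ?b ^ m *
        (of_nat ((m + 1) choose t) * of_nat ((m + 1 + n - t) choose (k - 2 * t)) *
          (?a ^ (k - 2 * t) * ?b ^ t)) =
      Rep_coh_BO2 (unThom (
        (of_nat ((m + 1) choose t) * of_nat ((m + n + 1 - t) choose (k - 2 * t)) :: bit)
          \<cdot> v (n + k - 2 * t) (m + t)))"
      unfolding e e' of_nat_mult[symmetric] scale Rep_unThom_v power_add
      by (simp only: mult_ac)
  qed
  \<comment> \<open>\<open>Rep_coh_BO2\<close> and \<open>unThom\<close> are additive and injective,
    so the identity lifts from polynomials to the Thom module.\<close>
  finally show ?thesis
    by (simp only: Rep_coh_BO2_sum[symmetric] unThom_sum[symmetric] Rep_coh_BO2_inject
        coh_MO2.expand)
qed

end
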